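(* For every $n\ge 1$, the set $\mathcal{A}_n$ of arc permutations in the symmetric group $\mathcal{S}_n$ satisfies $$\mathcal{A}_n=\mathcal{S}_n(1324,1342,2413,2431,3124,3142,4213,4231).$$
   Context: Permutations $\pi\in\mathcal{S}_n$ are written in one-line notation $\pi=\pi(1)\pi(2)\cdots\pi(n)$. An interval in $\mathbb{Z}_n$ is a subset of $\{1,\dots,n\}$ of the form $[a,b]=\{a,a+1,\dots,b\}$ or $[b,n]\cup[1,a]$ for some $1\le a\le b\le n$. A permutation $\pi\in\mathcal{S}_n$ is an arc permutation if for every $1\le j\le n$ the set $\{\pi(1),\dots,\pi(j)\}$ is an interval in $\mathbb{Z}_n$; $\mathcal{A}_n$ is the set of arc permutations in $\mathcal{S}_n$. For patterns $\tau_1,\tau_2,\dots$ (permutations in one-line notation), $\mathcal{S}_n(\tau_1,\tau_2,\dots)$ denotes the set of permutations in $\mathcal{S}_n$ that avoid all of the $\tau_i$, i.e. that contain no (not necessarily contiguous) subsequence whose entries are in the same relative order as those of $\tau_i$. *)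

theory Defs
  imports "HOL-Combinatorics.Permutations"
begin

text \<open>
  A permutation in \<open>S\<^sub>n\<close> is a function \<open>\<pi>\<close> with \<open>\<pi> permutes {1..n}\<close>;
  its one-line notation is \<open>\<pi> 1, \<dots>, \<pi> n\<close>.
\<close>

definition symmetric_group :: "nat \<Rightarrow> (nat \<Rightarrow> nat) set" where
  "symmetric_group n = {\<pi>. \<pi> permutes {1..n}}"

definition cyclic_interval :: "nat \<Rightarrow> nat set \<Rightarrow> bool" where
  "cyclic_interval n I \<longleftrightarrow>
     (\<exists>a b. 1 \<le> a \<and> a \<le> b \<and> b \<le> n \<and> (I = {a..b} \<or> I = {b..n} \<union> {1..a}))"

definition arc_permutations :: "nat \<Rightarrow> (nat \<Rightarrow> nat) set" where
  "arc_permutations n =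
     {\<pi> \<in> symmetric_group n. \<forall>j\<in>{1..n}. cyclic_interval n (\<pi> ` {1..j})}"

text \<open>
  A pattern \<open>\<tau>\<close> is the list of its values in one-line notation. The map \<open>p\<close> below selects
  the (increasing, not necessarily contiguous) positions of an occurrence of \<open>\<tau>\<close> in \<open>\<pi>\<close>;
  list positions count from 0, positions in \<open>\<pi>\<close> from 1.
\<close>

definition contains_pattern :: "nat \<Rightarrow> (nat \<Rightarrow> nat) \<Rightarrow> nat list \<Rightarrow> bool" where
  "contains_pattern n \<pi> \<tau> \<longleftrightarrow>
     (\<exists>p. strict_mono_on {..<length \<tau>} p \<and> p ` {..<length \<tau>} \<subseteq> {1..n} \<and>
        (\<forall>i<length \<tau>. \<forall>j<length \<tau>. \<pi> (p i) < \<pi> (p j) \<longleftrightarrow> \<tau> ! i < \<tau> ! j))"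

definition avoiding_permutations :: "nat \<Rightarrow> nat list set \<Rightarrow> (nat \<Rightarrow> nat) set" where
  "avoiding_permutations n T =
     {\<pi> \<in> symmetric_group n. \<forall>\<tau>\<in>T. \<not> contains_pattern n \<pi> \<tau>}"

end

theory Submission
  imports Defs
begin

text \<open>
  A nonempty subset of the cycle \<open>1, \<dots>, n\<close> is an interval iff no two of its points are separated
  by two points of its complement. The eight patterns are exactly the permutations of
  \<open>1, 2, 3, 4\<close> whose first two values separate the last two on the cycle. Hence an
  occurrence of a pattern is the same thing as an initial set \<open>\<pi> ` {1..j}\<close> that is
  not an interval.
\<close>

text \<open>This is the linear half of separation on the cycle. Cut between n and 1, four mutually
  separating points read a b a b or b a b a; the definition records only the first. Separation is
  therefore the disjunction of \<open>alternating A B\<close> and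
  \<open>alternating B A\<close>.\<close>

definition alternating :: "nat set \<Rightarrow> nat set \<Rightarrow> bool" where
  "alternating A B \<longleftrightarrow> (\<exists>a\<in>A. \<exists>b\<in>B. \<exists>c\<in>A. \<exists>d\<in>B. a < b \<and> b < c \<and> c < d)"

lemma alternatingI:
  "a \<in> A \<Longrightarrow> b \<in> B \<Longrightarrow> c \<in> A \<Longrightarrow> d \<in> B \<Longrightarrow> a < b \<Longrightarrow> b < c \<Longrightarrow> c < d \<Longrightarrow> alternating A B"
  unfolding alternating_def by blast

section \<open>Intervals of the cycle through alternation\<close>

lemma eq_interval_or_gap:
  fixes A :: "nat set"
  assumes "finite A" "A \<noteq> {}"
  obtains "A = {Min A..Max A}" | g where "g \<notin> A" "Min A < g" "g < Max A"
proof (cases "A = {Min A..Max A}")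
  case False
  moreover have "A \<subseteq> {Min A..Max A}"
    using assms by auto
  ultimately obtain g where "g \<notin> A" "g \<in> {Min A..Max A}"
    by blast
  moreover from this have "g \<noteq> Min A" "g \<noteq> Max A"
    using assms by (metis Min_in, metis Max_in)
  ultimately show ?thesis
    using that(2)[of g] by simp
qed (use that in blast)

text \<open>Either \<open>I\<close> or its complement is convex in the linear order, whereas any
  alternation puts a point of each set between two points of the other.\<close>

lemma cyclic_interval_not_alternating:
  assumes "cyclic_interval n I"
  shows "\<not> alternating I ({1..n} - I)" "\<not> alternating ({1..n} - I) I"
  using assms unfolding cyclic_interval_def alternating_def by fastforce+

text \<open>The position of the cut between n and 1 decides the case. If \<open>I\<close> misses 1
  or n, it has to be an ordinary interval, since a gap in it would alternate together with the
  missing end. If \<open>I\<close> contains both, the same argument applies to the complement, and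
  \<open>I\<close> wraps around.\<close>

lemma not_alternating_cyclic_interval:
  assumes sub: "I \<subseteq> {1..n}" and ne: "I \<noteq> {}"
    and alt: "\<not> alternating I ({1..n} - I)" "\<not> alternating ({1..n} - I) I"
  shows "cyclic_interval n I"
proof (cases "1 \<in> I \<and> n \<in> I")
  case False
  have fin: "finite I"
    using sub finite_subset by blast
  have mem: "Min I \<in> I" "Max I \<in> I"
    using fin ne by auto
  then have range: "1 \<le> Min I" "Min I \<le> Max I" "Max I \<le> n"
    using sub fin by auto
  from fin ne show ?thesis
  proof (cases rule: eq_interval_or_gap)
    case 1
    then show ?thesis
      using range unfolding cyclic_interval_def by blast
  next
    case (2 g)
    then have g: "g \<in> {1..n} - I"
      using range by auto
    from False show ?thesis
    proof (cases "1 \<in> I")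
      \<comment> \<open>The missing end supplies the fourth point: n on the right here, 1 on the
        left in the other case.\<close>
      case True
      with False have "n \<notin> I" by blast
      moreover from this have "Max I \<noteq> n"
        using mem by metis
      ultimately have "alternating I ({1..n} - I)"
        using mem g 2 range by (intro alternatingI[of "Min I" _ g _ "Max I" n]) auto
      with alt show ?thesis by blast
    next
      case False
      moreover from this have "Min I \<noteq> 1"
        using mem by metis
      ultimately have "alternating ({1..n} - I) I"
        using mem g 2 range by (intro alternatingI[of 1 _ "Min I" _ g "Max I"]) auto
      with alt show ?thesis by blast
    qed
  qed
next
  case True
  then have n: "1 \<le> n"
    using sub by auto
  let ?C = "{1..n} - I"
  show ?thesis
  proof (cases "?C = {}")
    case True
    then have "I = {1..n}" using sub by auto
    then show ?thesis
      using n unfolding cyclic_interval_def by blast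
  next
    case ne_C: False
    have fin: "finite ?C" by simp
    have mem: "Min ?C \<in> ?C" "Max ?C \<in> ?C"
      using Min_in[OF fin ne_C] Max_in[OF fin ne_C] by blast+
    then have "Min ?C \<noteq> 1" "Max ?C \<noteq> n" "1 \<le> Min ?C" "Max ?C \<le> n"
      using True by (metis DiffD2, metis DiffD2, auto)
    then have range: "1 < Min ?C" "Max ?C < n" by simp_all
    have le: "Min ?C \<le> Max ?C"
      using Min_le[OF fin mem(2)] .
    from fin ne_C show ?thesis
    proof (cases rule: eq_interval_or_gap)
      case 1
      \<comment> \<open>The names hide the complement inside its own endpoints, so that its equation
        can be substituted without recurring.\<close>
      define l r where "l = Min ?C" and "r = Max ?C"
      have "?C = {l..r}"
        using 1 unfolding l_def r_def .
      moreover have lr: "1 < l" "r < n" "l \<le> r"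
        using range le unfolding l_def r_def .
      moreover have "I = {1..n} - ?C"
        using sub by blast
      ultimately have "I = {1..n} - {l..r}"
        by simp
      also have "\<dots> = {Suc r..n} \<union> {1..l - 1}"
        using lr by auto
      finally have "I = {Suc r..n} \<union> {1..l - 1}" .
      \<comment> \<open>Since 1 < l and r < n, both arcs are nonempty, so \<open>l - 1\<close> and
        \<open>Suc r\<close> stay within the bounds that a cyclic interval requires.\<close>
      with lr show ?thesis
        unfolding cyclic_interval_def by (intro exI[of _ "l - 1"] exI[of _ "Suc r"]) auto
    next
      case (2 g)
      have "g \<in> I"
        using 2 range by auto
      then have "alternating I ?C"
        using 2 mem range True by (intro alternatingI[of 1 _ "Min ?C" _ g "Max ?C"]) auto
      with alt show ?thesis by blast
    qed
  qed
qed

lemma cyclic_interval_iff_not_alternating: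
  assumes "I \<subseteq> {1..n}" "I \<noteq> {}"
  shows "cyclic_interval n I \<longleftrightarrow> \<not> alternating I ({1..n} - I) \<and> \<not> alternating ({1..n} - I) I"
  using assms cyclic_interval_not_alternating not_alternating_cyclic_interval by blast

section \<open>Occurrences of the eight patterns\<close>

lemma contains_pattern_length_4_iff:
  "contains_pattern n \<pi> [t\<^sub>1, t\<^sub>2, t\<^sub>3, t\<^sub>4] \<longleftrightarrow>
    (\<exists>i j k l. 1 \<le> i \<and> i < j \<and> j < k \<and> k < l \<and> l \<le> n \<and>
      (\<forall>(p, s) \<in> {(i, t\<^sub>1), (j, t\<^sub>2), (k, t\<^sub>3), (l, t\<^sub>4)}.
        \<forall>(q, t) \<in> {(i, t\<^sub>1), (j, t\<^sub>2), (k, t\<^sub>3), (l, t\<^sub>4)}. \<pi> p < \<pi> q \<longleftrightarrow> s < t))"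
  (is "contains_pattern n \<pi> ?\<tau> \<longleftrightarrow> ?R")
proof
  assume "contains_pattern n \<pi> ?\<tau>"
  then obtain p where p: "strict_mono_on {..<length ?\<tau>} p" "p ` {..<length ?\<tau>} \<subseteq> {1..n}"
    "\<forall>i<length ?\<tau>. \<forall>j<length ?\<tau>. \<pi> (p i) < \<pi> (p j) \<longleftrightarrow> ?\<tau> ! i < ?\<tau> ! j"
    unfolding contains_pattern_def by blast
  have "p 0 < p 1" "p 1 < p 2" "p 2 < p 3"
    using p(1) by (auto simp: strict_mono_on_def)
  moreover have "1 \<le> p 0" "p 3 \<le> n"
    using p(2) by (auto simp: image_subset_iff)
  ultimately show ?R
    using p(3)
    by (intro exI[of _ "p 0"] exI[of _ "p 1"] exI[of _ "p 2"] exI[of _ "p 3"])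
      (simp add: eval_nat_numeral All_less_Suc2)
next
  assume ?R
  then obtain i j k l where pos: "1 \<le> i" "i < j" "j < k" "k < l" "l \<le> n"
    and order: "\<forall>(p, s) \<in> {(i, t\<^sub>1), (j, t\<^sub>2), (k, t\<^sub>3), (l, t\<^sub>4)}.
        \<forall>(q, t) \<in> {(i, t\<^sub>1), (j, t\<^sub>2), (k, t\<^sub>3), (l, t\<^sub>4)}. \<pi> p < \<pi> q \<longleftrightarrow> s < t"
    by blast
  \<comment> \<open>Only the values at 0, 1, 2, 3 matter, so indexing into the list of positions
    serves as the position map.\<close>
  let ?p = "(!) [i, j, k, l]"
  have "strict_mono_on {..<length ?\<tau>} ?p"
    unfolding strict_mono_on_def using pos by (auto simp: less_Suc_eq)
  moreover have "?p ` {..<length ?\<tau>} \<subseteq> {1..n}"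
    using pos by (auto simp: less_Suc_eq)
  moreover have "\<forall>a<length ?\<tau>. \<forall>b<length ?\<tau>. \<pi> (?p a) < \<pi> (?p b) \<longleftrightarrow> ?\<tau> ! a < ?\<tau> ! b"
    using order by (simp add: All_less_Suc2)
  ultimately show "contains_pattern n \<pi> ?\<tau>"
    unfolding contains_pattern_def by blast
qed

text \<open>Alternation is stated through < alone, so it carries over from the pattern to the
  entries of an occurrence. Both orientations are offered for the same positions, because the
  pattern decides which one holds.\<close>

lemma contains_pattern_alternating:
  assumes "contains_pattern n \<pi> [t\<^sub>1, t\<^sub>2, t\<^sub>3, t\<^sub>4]"
  obtains i j k l where "1 \<le> i" "i < j" "j < k" "k < l" "l \<le> n"
    "alternating {t\<^sub>1, t\<^sub>2} {t\<^sub>3, t\<^sub>4} \<Longrightarrow> alternating {\<pi> i, \<pi> j} {\<pi> k, \<pi> l}"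
    "alternating {t\<^sub>3, t\<^sub>4} {t\<^sub>1, t\<^sub>2} \<Longrightarrow> alternating {\<pi> k, \<pi> l} {\<pi> i, \<pi> j}"
proof -
  from assms obtain i j k l where pos: "1 \<le> i" "i < j" "j < k" "k < l" "l \<le> n"
    and order: "\<forall>(p, s) \<in> {(i, t\<^sub>1), (j, t\<^sub>2), (k, t\<^sub>3), (l, t\<^sub>4)}.
        \<forall>(q, t) \<in> {(i, t\<^sub>1), (j, t\<^sub>2), (k, t\<^sub>3), (l, t\<^sub>4)}. \<pi> p < \<pi> q \<longleftrightarrow> s < t"
    unfolding contains_pattern_length_4_iff by blast
  from pos show thesis
    by (rule that) (use order in \<open>simp_all add: alternating_def\<close>)
qed

abbreviation (input) separating_patterns :: "nat list set" where
  "separating_patterns \<equiv>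
    {[1,3,2,4], [1,3,4,2], [2,4,1,3], [2,4,3,1],
     [3,1,2,4], [3,1,4,2], [4,2,1,3], [4,2,3,1]}"

text \<open>An alternation of two pairs is determined by which pair holds the smallest value and by
  the order inside each pair. This gives 2 * 2 * 2 orders, one for each pattern.\<close>

lemma contains_separating_pattern_iff:
  "(\<exists>\<tau>\<in>separating_patterns. contains_pattern n \<pi> \<tau>) \<longleftrightarrow>
    (\<exists>i j k l. 1 \<le> i \<and> i < j \<and> j < k \<and> k < l \<and> l \<le> n \<and>
      (alternating {\<pi> i, \<pi> j} {\<pi> k, \<pi> l} \<or> alternating {\<pi> k, \<pi> l} {\<pi> i, \<pi> j}))"
  (is "?L \<longleftrightarrow> ?R")
proof
  have "\<exists>t\<^sub>1 t\<^sub>2 t\<^sub>3 t\<^sub>4. \<tau> = [t\<^sub>1, t\<^sub>2, t\<^sub>3, t\<^sub>4] \<and>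
      (alternating {t\<^sub>1, t\<^sub>2} {t\<^sub>3, t\<^sub>4} \<or> alternating {t\<^sub>3, t\<^sub>4} {t\<^sub>1, t\<^sub>2})"
    if "\<tau> \<in> separating_patterns" for \<tau> :: "nat list"
    using that by (elim insertE emptyE) (simp_all add: alternating_def)
  moreover assume ?L
  ultimately obtain t\<^sub>1 t\<^sub>2 t\<^sub>3 t\<^sub>4 where "contains_pattern n \<pi> [t\<^sub>1, t\<^sub>2, t\<^sub>3, t\<^sub>4]"
    "alternating {t\<^sub>1, t\<^sub>2} {t\<^sub>3, t\<^sub>4} \<or> alternating {t\<^sub>3, t\<^sub>4} {t\<^sub>1, t\<^sub>2}"
    by metis
  then show ?R
    by (elim contains_pattern_alternating) blast
next
  assume ?R
  then obtain i j k l where pos: "1 \<le> i" "i < j" "j < k" "k < l" "l \<le> n"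
    and alt: "alternating {\<pi> i, \<pi> j} {\<pi> k, \<pi> l} \<or> alternating {\<pi> k, \<pi> l} {\<pi> i, \<pi> j}"
    by blast
  have witness: "contains_pattern n \<pi> [t\<^sub>1, t\<^sub>2, t\<^sub>3, t\<^sub>4]"
    if "\<forall>(p, s) \<in> {(i, t\<^sub>1), (j, t\<^sub>2), (k, t\<^sub>3), (l, t\<^sub>4)}.
        \<forall>(q, t) \<in> {(i, t\<^sub>1), (j, t\<^sub>2), (k, t\<^sub>3), (l, t\<^sub>4)}. \<pi> p < \<pi> q \<longleftrightarrow> s < t"
    for t\<^sub>1 t\<^sub>2 t\<^sub>3 t\<^sub>4
    unfolding contains_pattern_length_4_iff using pos that by blast
  \<comment> \<open>Each chain sorts the positions by value, and the pattern is the inverse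
    arrangement: the order l, i, k, j in the fourth case gives 2431.\<close>
  consider
      "\<pi> i < \<pi> k" "\<pi> k < \<pi> j" "\<pi> j < \<pi> l" | "\<pi> i < \<pi> l" "\<pi> l < \<pi> j" "\<pi> j < \<pi> k"
    | "\<pi> k < \<pi> i" "\<pi> i < \<pi> l" "\<pi> l < \<pi> j" | "\<pi> l < \<pi> i" "\<pi> i < \<pi> k" "\<pi> k < \<pi> j"
    | "\<pi> j < \<pi> k" "\<pi> k < \<pi> i" "\<pi> i < \<pi> l" | "\<pi> j < \<pi> l" "\<pi> l < \<pi> i" "\<pi> i < \<pi> k"
    | "\<pi> k < \<pi> j" "\<pi> j < \<pi> l" "\<pi> l < \<pi> i" | "\<pi> l < \<pi> j" "\<pi> j < \<pi> k" "\<pi> k < \<pi> i"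
    using alt unfolding alternating_def by auto
  then show ?L
  proof cases
    case 1 then show ?thesis using witness[of 1 3 2 4] by simp
  next
    case 2 then show ?thesis using witness[of 1 3 4 2] by simp
  next
    case 3 then show ?thesis using witness[of 2 4 1 3] by simp
  next
    case 4 then show ?thesis using witness[of 2 4 3 1] by simp
  next
    case 5 then show ?thesis using witness[of 3 1 2 4] by simp
  next
    case 6 then show ?thesis using witness[of 3 1 4 2] by simp
  next
    case 7 then show ?thesis using witness[of 4 2 1 3] by simp
  next
    case 8 then show ?thesis using witness[of 4 2 3 1] by simp
  qed
qed

section \<open>From initial sets to positions\<close>

lemma alternating_mono:
  "alternating A B \<Longrightarrow> A \<subseteq> A' \<Longrightarrow> B \<subseteq> B' \<Longrightarrow> alternating A' B'"
  unfolding alternating_def by blast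

text \<open>Distinctness is recorded because \<open>image_pair_increasing\<close> needs it to order
  the two positions.\<close>

lemma alternating_pairs:
  assumes "alternating A B"
  obtains a c b d where "a \<in> A" "c \<in> A" "b \<in> B" "d \<in> B" "a \<noteq> c" "b \<noteq> d"
    "alternating {a, c} {b, d}"
proof -
  from assms obtain a b c d where "a \<in> A" "b \<in> B" "c \<in> A" "d \<in> B" "a < b" "b < c" "c < d"
    unfolding alternating_def by blast
  moreover from this have "alternating {a, c} {b, d}"
    by (intro alternatingI[of a _ b _ c d]) auto
  ultimately show thesis
    using that[of a c b d] by simp
qed

text \<open>Alternation sees only the set of the two values, so their positions may be sorted
  without tracking which one carries \<open>x\<close>.\<close>

lemma image_pair_increasing:
  fixes S :: "nat set"
  assumes "x \<in> f ` S" "y \<in> f ` S" "x \<noteq> y"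
  obtains i j where "i \<in> S" "j \<in> S" "i < j" "{f i, f j} = {x, y}"
proof -
  from assms obtain i j where ij: "i \<in> S" "j \<in> S" "x = f i" "y = f j" "i \<noteq> j"
    by blast
  from \<open>i \<noteq> j\<close> consider "i < j" | "j < i"
    by linarith
  then show thesis
    using that[of i j] that[of j i] ij by cases (simp_all add: insert_commute)
qed

lemma arc_iff_not_alternating:
  assumes perm: "\<pi> permutes {1..n}"
  shows "(\<forall>j\<in>{1..n}. cyclic_interval n (\<pi> ` {1..j})) \<longleftrightarrow>
    \<not> (\<exists>i j k l. 1 \<le> i \<and> i < j \<and> j < k \<and> k < l \<and> l \<le> n \<and>
      (alternating {\<pi> i, \<pi> j} {\<pi> k, \<pi> l} \<or> alternating {\<pi> k, \<pi> l} {\<pi> i, \<pi> j}))"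
  (is "?L \<longleftrightarrow> \<not> ?R")
proof -
  have interval_iff: "cyclic_interval n (\<pi> ` {1..j}) \<longleftrightarrow>
      \<not> alternating (\<pi> ` {1..j}) (\<pi> ` {Suc j..n}) \<and> \<not> alternating (\<pi> ` {Suc j..n}) (\<pi> ` {1..j})"
    if "j \<in> {1..n}" for j
  proof -
    \<comment> \<open>As \<pi> is a bijection of {1..n}, the values outside an initial set are those
      at the later positions.\<close>
    have "{1..n} - \<pi> ` {1..j} = \<pi> ` ({1..n} - {1..j})"
      using perm permutes_image[OF perm] by (metis image_set_diff permutes_inj)
    also have "{1..n} - {1..j} = {Suc j..n}"
      by auto
    finally have compl: "{1..n} - \<pi> ` {1..j} = \<pi> ` {Suc j..n}" .
    have "\<pi> ` {1..j} \<subseteq> \<pi> ` {1..n}"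
      using that by (intro image_mono) auto
    then have "\<pi> ` {1..j} \<subseteq> {1..n}"
      using permutes_image[OF perm] by simp
    with that show ?thesis
      unfolding compl[symmetric] by (intro cyclic_interval_iff_not_alternating) auto
  qed
  show ?thesis
  proof
    assume arc: ?L
    show "\<not> ?R"
    proof
      assume ?R
      then obtain i j k l where pos: "1 \<le> i" "i < j" "j < k" "k < l" "l \<le> n"
        and alt: "alternating {\<pi> i, \<pi> j} {\<pi> k, \<pi> l} \<or> alternating {\<pi> k, \<pi> l} {\<pi> i, \<pi> j}"
        by blast
      \<comment> \<open>Cutting between the second and third positions of the occurrence puts its
        two pairs on opposite sides.\<close>
      from pos have "j \<in> {1..n}" "{\<pi> i, \<pi> j} \<subseteq> \<pi> ` {1..j}" "{\<pi> k, \<pi> l} \<subseteq> \<pi> ` {Suc j..n}"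
        by auto
      with arc interval_iff alt show False
        by (meson alternating_mono)
    qed
  next
    assume no_alt: "\<not> ?R"
    show ?L
    proof (rule ballI, rule ccontr)
      fix m assume m: "m \<in> {1..n}" and "\<not> cyclic_interval n (\<pi> ` {1..m})"
      then obtain a c b d where "a \<in> \<pi> ` {1..m}" "c \<in> \<pi> ` {1..m}" "a \<noteq> c"
        "b \<in> \<pi> ` {Suc m..n}" "d \<in> \<pi> ` {Suc m..n}" "b \<noteq> d"
        and alt: "alternating {a, c} {b, d} \<or> alternating {b, d} {a, c}"
        unfolding interval_iff[OF m] by (metis alternating_pairs)
      then obtain i j k l where "i \<in> {1..m}" "j \<in> {1..m}" "i < j" "{\<pi> i, \<pi> j} = {a, c}"
        "k \<in> {Suc m..n}" "l \<in> {Suc m..n}" "k < l" "{\<pi> k, \<pi> l} = {b, d}"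
        by (metis image_pair_increasing)
      \<comment> \<open>The cut at \<open>m\<close> gives j \<le> m < k, which joins the two sorted
        pairs into one increasing quadruple.\<close>
      moreover from this have "1 \<le> i" "j < k" "l \<le> n" by auto
      ultimately show False
        using no_alt alt by metis
    qed
  qed
qed

theorem theorem3p2:
  fixes n :: nat
  assumes "n \<ge> 1"
  shows "arc_permutations n = avoiding_permutations n
    {[1,3,2,4], [1,3,4,2], [2,4,1,3], [2,4,3,1],
     [3,1,2,4], [3,1,4,2], [4,2,1,3], [4,2,3,1]}"
proof -
  have "(\<forall>j\<in>{1..n}. cyclic_interval n (\<pi> ` {1..j})) \<longleftrightarrow>
      (\<forall>\<tau>\<in>separating_patterns. \<not> contains_pattern n \<pi> \<tau>)"
    if "\<pi> \<in> symmetric_group n" for \<pi>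
  proof -
    have "\<pi> permutes {1..n}"
      using that unfolding symmetric_group_def by simp
    then have "(\<forall>j\<in>{1..n}. cyclic_interval n (\<pi> ` {1..j})) \<longleftrightarrow>
        \<not> (\<exists>\<tau>\<in>separating_patterns. contains_pattern n \<pi> \<tau>)"
      unfolding contains_separating_pattern_iff by (rule arc_iff_not_alternating)
    then show ?thesis
      by (simp only: bex_simps ball_simps de_Morgan_disj not_False_eq_True)
  qed
  then show ?thesis
    unfolding arc_permutations_def avoiding_permutations_def
    by (rule Collect_cong[OF conj_cong[OF refl]])
qed

end
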